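(* Let $\mathbb{D}$ be the open unit disk, let $K(z,w)=1+\sum_{i=1}^{\infty}a_iz^i\overline w^{\,i}$ be a positive definite kernel on $\mathbb{D}\times\mathbb{D}$, and let $p\in\mathbb{N}$ (with $p\ge1$). Then $$\frac{\partial^2}{\partial z\,\partial\overline w}\log K(z,w)=[K(z,w)]^p$$ if and only if $$K(z,w)=\left(1-\frac{p\,z\overline w}{2}\right)^{-\frac2p}.$$
   Context: A kernel $L(z,w)$, holomorphic in $z$ and anti-holomorphic in $w$, is positive definite if all matrices $(L(z_p,z_q))_{p,q}$ are positive semidefinite. The expression $\frac{\partial^2}{\partial z\partial\overline w}\log K$ means $\frac{K\,\partial_z\partial_{\overline w}K-\partial_zK\,\partial_{\overline w}K}{K^2}$ (the branch of the logarithm is irrelevant). The power $(1-\frac{p z\overline w}{2})^{-2/p}$ is the branch with value $1$ at $z\overline w=0$, i.e. the corresponding binomial power series in $z\overline w$. *)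

theory Defs
  imports "HOL-Complex_Analysis.Complex_Analysis"
begin

text \<open>Wirtinger derivatives, from the real Frechet derivative \<open>Df\<close>:
  \<open>Df 1\<close> and \<open>Df \<i>\<close> are the partial derivatives in the real and
  imaginary directions.\<close>

definition wirtinger :: "(complex \<Rightarrow> complex) \<Rightarrow> complex \<Rightarrow> complex" where
  "wirtinger f z =
     (frechet_derivative f (at z) 1 - \<i> * frechet_derivative f (at z) \<i>) / 2"

definition wirtinger_bar :: "(complex \<Rightarrow> complex) \<Rightarrow> complex \<Rightarrow> complex" where
  "wirtinger_bar f z =
     (frechet_derivative f (at z) 1 + \<i> * frechet_derivative f (at z) \<i>) / 2"

text \<open>The mixed derivative of \<open>log K\<close> in \<open>z\<close> and \<open>cnj w\<close>, written without a logarithm.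
  It is meaningful only where \<open>K z w \<noteq> 0\<close>.\<close>

definition mixed_deriv_log :: "(complex \<Rightarrow> complex \<Rightarrow> complex) \<Rightarrow> complex \<Rightarrow> complex \<Rightarrow> complex" where
  "mixed_deriv_log K z w =
     (K z w * wirtinger (\<lambda>x. wirtinger_bar (\<lambda>y. K x y) w) z
        - wirtinger (\<lambda>x. K x w) z * wirtinger_bar (\<lambda>y. K z y) w) / (K z w)\<^sup>2"

text \<open>The points need not be distinct. Membership in \<open>\<real>\<^sub>\<ge>\<^sub>0\<close> says that the value of the
  Hermitian form is real and nonnegative, so each matrix is in particular Hermitian.\<close>

definition positive_definite_kernel_on ::
    "'a set \<Rightarrow> ('a \<Rightarrow> 'a \<Rightarrow> complex) \<Rightarrow> bool" where
  "positive_definite_kernel_on S L \<longleftrightarrow>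
     (\<forall>n (x :: nat \<Rightarrow> 'a) (c :: nat \<Rightarrow> complex). (\<forall>i<n. x i \<in> S) \<longrightarrow>
        (\<Sum>i<n. \<Sum>j<n. cnj (c i) * L (x i) (x j) * c j) \<in> \<real>\<^sub>\<ge>\<^sub>0)"

end

theory Submission imports Defs begin

text \<open>Write \<open>K z w = f (z * cnj w)\<close> with \<open>f\<close> holomorphic on the unit disk and \<open>f 0 = 1\<close>. In the
  variable \<open>t = z * cnj w\<close> the curvature equation is
  \<open>f * (f' + t * f'') - t * f'^2 = f ^ (p + 2)\<close>, while the binomial series is characterised,
  coefficient by coefficient, by \<open>(1 - p * t / 2) * f' = f\<close>.

  To pass from the second order equation to the first order one, put \<open>g = t * f' / f\<close>. Then
  \<open>g' = f ^ p\<close>, which makes \<open>t * f ^ p - g - p * g^2 / 2\<close> constant; this is the first integral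
  \<open>q' = p * q^2 / 2\<close> for \<open>q = f' / f\<close>, and the latter makes
  \<open>((1 - p * t / 2) * q - 1)^2 / f ^ p\<close> constant. Conversely, the first order equation makes
  \<open>f ^ p * (1 - p * t / 2)^2\<close> constant, so \<open>f\<close> has no zeros.

  For \<open>p \<ge> 3\<close> both sides of the equivalence are false, because the binomial series has radius of
  convergence \<open>2 / p < 1\<close>; comparing coefficients avoids this case distinction.\<close>

section \<open>Wirtinger derivatives of kernels that depend on \<open>z * cnj w\<close> only\<close>

lemma wirtinger_eq:
  assumes "(f has_field_derivative d) (at z)"
  shows "wirtinger f z = d"
proof -
  have "frechet_derivative f (at z) = (*) d"
    using frechet_derivative_at assms unfolding has_field_derivative_def by metis
  then show ?thesis by (simp add: wirtinger_def algebra_simps)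
qed

text \<open>The real derivative of \<open>h \<circ> cnj\<close> at \<open>w\<close> sends
  \<open>y\<close> to \<open>d * cnj y\<close>, and the two partial derivatives \<open>d\<close> and
  \<open>- \<i> * d\<close> recombine to \<open>d\<close>. Agreement on an open set suffices, which
  matters because \<open>K\<close> is prescribed on the disk only.\<close>

lemma wirtinger_bar_eq:
  assumes "(h has_field_derivative d) (at (cnj w))"
    and "open S" "w \<in> S" "\<And>y. y \<in> S \<Longrightarrow> f y = h (cnj y)"
  shows "wirtinger_bar f w = d"
proof -
  have "((\<lambda>y. h (cnj y)) has_derivative (\<lambda>y. d * cnj y)) (at w)"
    using has_derivative_compose[of cnj cnj w UNIV h "(*) d"] assms(1)
    by (auto simp: has_field_derivative_def intro: has_derivative_cnj has_derivative_ident)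
  then have "(f has_derivative (\<lambda>y. d * cnj y)) (at w)"
    by (rule has_derivative_transform_within_open[OF _ assms(2,3)]) (simp add: assms(4))
  then have "frechet_derivative f (at w) = (\<lambda>y. d * cnj y)"
    using frechet_derivative_at by metis
  then show ?thesis by (simp add: wirtinger_bar_def algebra_simps)
qed

lemma mult_cnj_in_ball:
  "z \<in> ball 0 1 \<Longrightarrow> w \<in> ball 0 1 \<Longrightarrow> z * cnj w \<in> ball (0::complex) 1"
  using mult_strict_mono'[of "cmod z" 1 "cmod w" 1] by (simp add: norm_mult)

text \<open>By the chain rule the derivative in \<open>cnj w\<close> is \<open>z * f' t\<close>, and
  differentiating this in \<open>z\<close> gives \<open>f' t + t * f'' t\<close>. The product of the
  two first derivatives is \<open>(cnj w * f' t) * (z * f' t)\<close>, that is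
  \<open>t * (f' t)\<^sup>2\<close>.\<close>

lemma mixed_deriv_log_mult_cnj:
  assumes f: "\<And>t. t \<in> ball 0 1 \<Longrightarrow> (f has_field_derivative f' t) (at t)"
    and f': "\<And>t. t \<in> ball 0 1 \<Longrightarrow> (f' has_field_derivative f'' t) (at t)"
    and K: "\<And>z w. z \<in> ball 0 1 \<Longrightarrow> w \<in> ball 0 1 \<Longrightarrow> K z w = f (z * cnj w)"
    and z: "z \<in> ball 0 1" and w: "w \<in> ball 0 1"
    and t: "t = z * cnj w"
  shows "mixed_deriv_log K z w = (f t * (f' t + t * f'' t) - t * (f' t)\<^sup>2) / (f t)\<^sup>2"
proof -
  have tb: "x * cnj y \<in> ball 0 1" if "x \<in> ball 0 1" "y \<in> ball 0 1" for x y :: complex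
    using that by (rule mult_cnj_in_ball)
  have df: "(f has_field_derivative f' (x * cnj y)) (at (x * cnj y))"
    and df': "(f' has_field_derivative f'' (x * cnj y)) (at (x * cnj y))"
    if "x \<in> ball 0 1" "y \<in> ball 0 1" for x y
    using f f' tb that by blast+
  have bar: "wirtinger_bar (\<lambda>y. K x y) w = x * f' (x * cnj w)" if x: "x \<in> ball 0 1" for x
  proof (rule wirtinger_bar_eq[OF _ open_ball w])
    show "((\<lambda>y. f (x * y)) has_field_derivative x * f' (x * cnj w)) (at (cnj w))"
      by (rule DERIV_cong[OF DERIV_chain2[where g = "\<lambda>y. x * y", OF df[OF x w]]])
         (auto intro!: derivative_eq_intros)
    show "K x y = f (x * cnj y)" if "y \<in> ball 0 1" for y
      using K x that by blast
  qed
  have mult_w: "((\<lambda>x. x * cnj w) has_field_derivative cnj w) (at z)"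
    by (auto intro!: derivative_eq_intros)
  have "((\<lambda>x. f (x * cnj w)) has_field_derivative cnj w * f' t) (at z)"
    using DERIV_chain2[where f = f and g = "\<lambda>x. x * cnj w", OF df[OF z w] mult_w] by (simp add: t mult_ac)
  then have "((\<lambda>x. K x w) has_field_derivative cnj w * f' t) (at z)"
    by (rule has_field_derivative_transform_within_open[OF _ open_ball z]) (use K w in auto)
  then have 1: "wirtinger (\<lambda>x. K x w) z = cnj w * f' t"
    by (rule wirtinger_eq)
  have "((\<lambda>x. x * f' (x * cnj w)) has_field_derivative f' t + t * f'' t) (at z)"
    by (rule derivative_eq_intros refl mult_w
        DERIV_chain2[where f = f' and g = "\<lambda>x. x * cnj w", OF df'[OF z w]] | simp add: t)+
  then have "((\<lambda>x. wirtinger_bar (\<lambda>y. K x y) w) has_field_derivative f' t + t * f'' t) (at z)"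
    by (rule has_field_derivative_transform_within_open[OF _ open_ball z]) (simp add: bar)
  then have 2: "wirtinger (\<lambda>x. wirtinger_bar (\<lambda>y. K x y) w) z = f' t + t * f'' t"
    by (rule wirtinger_eq)
  show ?thesis
    unfolding mixed_deriv_log_def 1 2 bar[OF z] K[OF z w]
    by (simp add: t power2_eq_square algebra_simps)
qed

section \<open>Power series identities and coefficient recursions\<close>

lemma powser_coeffs_eq_0:
  fixes c :: "nat \<Rightarrow> complex"
  assumes "\<And>t. t \<in> ball 0 1 \<Longrightarrow> (\<lambda>n. c n * t ^ n) sums 0"
  shows "c n = 0"
proof (rule ccontr)
  assume n: "c n \<noteq> 0"
  have "c 0 = 0"
    using assms[of 0] by simp
  with n have "n > 0"
    by (cases n) auto
  \<comment> \<open>Zeros are isolated: a nonzero coefficient of positive index would make the sum,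
    here the zero function, nonvanishing on a punctured disk around 0.\<close>
  then obtain s where "0 < s" and "\<And>z::complex. z \<in> cball 0 s - {0} \<Longrightarrow> (0::complex) \<noteq> 0"
    using powser_0_nonzero[of 1 0 c "\<lambda>_. 0" n] assms n by auto
  from this(2)[of "of_real s"] this(1) show False
    by simp
qed

text \<open>The coefficient of \<open>t ^ n\<close> in \<open>(1 - k * t) * f' t - f t\<close> is
  the difference of the two sides of the recursion, so the claim is uniqueness of
  coefficients.\<close>

lemma powser_first_order_ode:
  fixes c :: "nat \<Rightarrow> complex"
  assumes sums: "\<And>t. t \<in> ball 0 1 \<Longrightarrow> (\<lambda>n. c n * t ^ n) sums f t"
    and f': "\<And>t. t \<in> ball 0 1 \<Longrightarrow> (f has_field_derivative f' t) (at t)"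
  shows "(\<forall>t\<in>ball 0 1. (1 - k * t) * f' t = f t) \<longleftrightarrow>
         (\<forall>n. of_nat (Suc n) * c (Suc n) = (1 + k * of_nat n) * c n)"
proof -
  define d where "d n = of_nat (Suc n) * c (Suc n) - (1 + k * of_nat n) * c n" for n
  have d: "(\<lambda>n. d n * t ^ n) sums ((1 - k * t) * f' t - f t)" if t: "t \<in> ball 0 1" for t
  proof -
    have s: "(\<lambda>n. of_nat (Suc n) * c (Suc n) * t ^ n) sums f' t"
      using termdiffs_sums_strong[of 1 c f "f' t" t] sums f'[OF t] t by (simp add: diffs_def)
    have "(\<lambda>n. of_nat (Suc n) * c (Suc n) * t ^ Suc n) sums (t * f' t)"
      using sums_mult[OF s, of t] by (simp add: mult_ac)
    \<comment> \<open>Shifting the index back adds only the term at \<open>n = 0\<close>, which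
      vanishes.\<close>
    then have "(\<lambda>n. of_nat n * c n * t ^ n) sums (t * f' t)"
      using sums_Suc[of "\<lambda>n. of_nat n * c n * t ^ n"] by simp
    from sums_diff[OF sums_diff[OF s sums_mult[OF this, of k]] sums[OF t]]
    show ?thesis
      by (simp add: d_def algebra_simps)
  qed
  show ?thesis
  proof
    assume ode: "\<forall>t\<in>ball 0 1. (1 - k * t) * f' t = f t"
    have "d n = 0" for n
      by (rule powser_coeffs_eq_0) (use d ode in force)
    then show "\<forall>n. of_nat (Suc n) * c (Suc n) = (1 + k * of_nat n) * c n"
      by (simp add: d_def)
  next
    assume "\<forall>n. of_nat (Suc n) * c (Suc n) = (1 + k * of_nat n) * c n"
    then have "d = (\<lambda>_. 0)"
      by (auto simp: d_def simp del: of_nat_Suc)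
    then have "(1 - k * t) * f' t - f t = 0" if "t \<in> ball 0 1" for t
      using d[OF that] by (simp add: sums_iff)
    then show "\<forall>t\<in>ball 0 1. (1 - k * t) * f' t = f t"
      by simp
  qed
qed

section \<open>The curvature equation and the first order equation in \<open>t\<close>\<close>

lemma first_order_ode_of_curvature:
  fixes f :: "complex \<Rightarrow> complex"
  assumes f': "\<And>t. t \<in> ball 0 1 \<Longrightarrow> (f has_field_derivative f' t) (at t)"
    and f'': "\<And>t. t \<in> ball 0 1 \<Longrightarrow> (f' has_field_derivative f'' t) (at t)"
    and nz: "\<And>t. t \<in> ball 0 1 \<Longrightarrow> f t \<noteq> 0"
    and "f 0 = 1"
    and curv: "\<And>t. t \<in> ball 0 1 \<Longrightarrow>
                 f t * (f' t + t * f'' t) - t * (f' t)\<^sup>2 = f t ^ p * (f t)\<^sup>2"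
    and t: "t \<in> ball 0 1"
  shows "(1 - of_nat p / 2 * t) * f' t = f t"
proof -
  define k where "k = (of_nat p / 2 :: complex)"
  have "f' 0 = 1"
    using curv[of 0] \<open>f 0 = 1\<close> by simp
  \<comment> \<open>The logarithmic derivative avoids the exponent \<open>p - 1\<close>, so that the
    same form covers \<open>p = 0\<close>.\<close>
  have powp: "((\<lambda>t. f t ^ p) has_field_derivative 2 * k * f t ^ p * (f' t / f t)) (at t)"
    if "t \<in> ball 0 1" for t
  proof (cases p)
    case (Suc m)
    have "((\<lambda>t. f t ^ Suc m) has_field_derivative of_nat (Suc m) * f t ^ m * f' t) (at t)"
      by (rule derivative_eq_intros refl f'[OF that])+ simp
    moreover have "of_nat (Suc m) * f t ^ m * f' t = 2 * k * f t ^ p * (f' t / f t)"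
      using nz[OF that] by (simp add: k_def Suc field_simps)
    ultimately show ?thesis
      by (simp only: Suc)
  qed (simp add: k_def)
  define g where "g t = t * f' t / f t" for t
  \<comment> \<open>The quotient rule for \<open>g\<close> yields the left side of the curvature
    equation divided by \<open>(f t)\<^sup>2\<close>.\<close>
  have g': "(g has_field_derivative f t ^ p) (at t)" if "t \<in> ball 0 1" for t
    unfolding g_def using nz[OF that] curv[OF that]
    by (auto intro!: derivative_eq_intros f'[OF that] f''[OF that]
        simp: divide_simps power2_eq_square) (simp add: algebra_simps)
  \<comment> \<open>Since \<open>t * f' t / f t = g t\<close>, the terms
    \<open>2 * k * f t ^ p * g t\<close> cancel, as do the two terms \<open>f t ^ p\<close>.\<close>
  have "((\<lambda>t. t * f t ^ p - g t - k * (g t)\<^sup>2) has_field_derivative 0) (at t within ball 0 1)"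
    if "t \<in> ball 0 1" for t
    by (rule has_field_derivative_at_within)
       (rule derivative_eq_intros refl g'[OF that] powp[OF that]
         | simp add: g_def[of t] algebra_simps)+
  then obtain c where c: "\<And>t. t \<in> ball 0 1 \<Longrightarrow> t * f t ^ p - g t - k * (g t)\<^sup>2 = c"
    using has_field_derivative_zero_constant[of "ball 0 1" "\<lambda>t. t * f t ^ p - g t - k * (g t)\<^sup>2"]
    by auto
  have "c = 0"
    using c[of 0] by (simp add: g_def)
  \<comment> \<open>This is \<open>q' = k * q\<^sup>2\<close> for \<open>q = f' / f\<close>, cleared
    of denominators. It results from eliminating \<open>f t ^ p\<close> between the first integral
    and the curvature equation; the divisions by \<open>t\<close> exclude the origin.\<close>
  have riccati: "f t * f'' t = (1 + k) * (f' t)\<^sup>2" if t: "t \<in> ball 0 1" "t \<noteq> 0" for t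
  proof -
    have "t * (f t ^ p * (f t)\<^sup>2) = t * (f t * f' t + k * t * (f' t)\<^sup>2)"
    proof -
      define q where "q = f' t / f t"
      have f'_eq: "f' t = q * f t" and "t * f t ^ p = t * q + k * (t * q)\<^sup>2"
        using c[OF t(1)] nz[OF t(1)] by (auto simp: q_def \<open>c = 0\<close> g_def algebra_simps)
      then have "t * (f t ^ p * (f t)\<^sup>2) = (t * q + k * (t * q)\<^sup>2) * (f t)\<^sup>2"
        by (metis mult.assoc)
      then show ?thesis
        unfolding f'_eq by (simp add: power2_eq_square algebra_simps)
    qed
    then have "f t ^ p * (f t)\<^sup>2 = f t * f' t + k * t * (f' t)\<^sup>2"
      using t(2) by simp
    then have "t * (f t * f'' t) = t * ((1 + k) * (f' t)\<^sup>2)"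
      using curv[OF t(1)] by (simp add: algebra_simps)
    then show ?thesis
      using t(2) by simp
  qed
  \<comment> \<open>\<open>D\<close> measures the failure of the first order equation.
    \<open>N\<close> collects the failure of the Riccati equation and so vanishes for
    \<open>t \<noteq> 0\<close>.\<close>
  define D where "D t = (1 - k * t) * f' t / f t - 1" for t
  define N where "N t = (1 - k * t) * (f t * f'' t - (1 + k) * (f' t)\<^sup>2) / (f t)\<^sup>2" for t
  have D': "(D has_field_derivative k * D t * (f' t / f t) + N t) (at t)"
    if "t \<in> ball 0 1" for t
  proof -
    have "(D has_field_derivative
        (((1 - k * t) * f'' t - k * f' t) * f t - (1 - k * t) * f' t * f' t) / (f t * f t)) (at t)"
      unfolding D_def
      by (rule derivative_eq_intros refl f'[OF that] f''[OF that] nz[OF that] | simp)+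
    also have "(((1 - k * t) * f'' t - k * f' t) * f t - (1 - k * t) * f' t * f' t) / (f t * f t)
        = k * D t * (f' t / f t) + N t"
      unfolding D_def N_def using nz[OF that]
      by (simp add: divide_simps power2_eq_square) (simp add: algebra_simps)
    finally show ?thesis .
  qed
  \<comment> \<open>Where \<open>N\<close> vanishes, \<open>D' = k * D * f' / f\<close>, so
    \<open>(D t)\<^sup>2\<close> grows at the same logarithmic rate \<open>2 * k * f' / f\<close> as
    \<open>f t ^ p\<close>.\<close>
  define W where "W t = (D t)\<^sup>2 / f t ^ p" for t
  have W': "(W has_field_derivative 2 * D t * N t / f t ^ p) (at t)" if "t \<in> ball 0 1" for t
  proof -
    have "(W has_field_derivative
        (2 * D t * (k * D t * (f' t / f t) + N t) * f t ^ p
          - (D t)\<^sup>2 * (2 * k * f t ^ p * (f' t / f t))) / (f t ^ p * f t ^ p)) (at t)"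
      unfolding W_def using nz[OF that]
      by (intro DERIV_divide powp[OF that] power_not_zero)
         (auto intro!: derivative_eq_intros D'[OF that])
    also have "(2 * D t * (k * D t * (f' t / f t) + N t) * f t ^ p
          - (D t)\<^sup>2 * (2 * k * f t ^ p * (f' t / f t))) / (f t ^ p * f t ^ p)
        = 2 * D t * N t * f t ^ p / (f t ^ p * f t ^ p)"
      by (simp add: power2_eq_square algebra_simps)
    also have "\<dots> = 2 * D t * N t / f t ^ p"
      using nz[OF that] by simp
    finally show ?thesis .
  qed
  \<comment> \<open>The derivative of \<open>W\<close> is known to vanish only off the origin;
    continuity bridges that single point. The constant is 0 because \<open>D 0 = 0\<close>.\<close>
  obtain e where e: "\<And>t. t \<in> ball 0 1 \<Longrightarrow> W t = e"
  proof (rule DERIV_zero_connected_constant[of "ball 0 1" "{0}" W])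
    show "continuous_on (ball 0 1) W"
      using W' by (meson DERIV_isCont continuous_at_imp_continuous_on)
    show "\<forall>t\<in>ball 0 1 - {0}. (W has_field_derivative 0) (at t)"
      using W' riccati by (fastforce simp: N_def)
  qed auto
  have "W t = W 0"
    using e[OF t] e[of 0] by simp
  then have "(1 - k * t) * f' t / f t = 1"
    using nz[OF t] \<open>f 0 = 1\<close> \<open>f' 0 = 1\<close> by (simp add: W_def D_def)
  then show ?thesis
    using nz[OF t] by (simp add: k_def field_simps)
qed

text \<open>With \<open>u = 1 - k * t\<close> and \<open>k = p / 2\<close>, one has
  \<open>f = u * f'\<close> and, after differentiation, \<open>u * f'' = (1 + k) * f'\<close>. Hence
  the left side collapses to \<open>(f' t)\<^sup>2\<close>, and the conserved quantity
  \<open>f t ^ p * u\<^sup>2 = 1\<close> turns this into the right side.\<close>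

lemma curvature_of_first_order_ode:
  fixes f :: "complex \<Rightarrow> complex"
  assumes f': "\<And>t. t \<in> ball 0 1 \<Longrightarrow> (f has_field_derivative f' t) (at t)"
    and f'': "\<And>t. t \<in> ball 0 1 \<Longrightarrow> (f' has_field_derivative f'' t) (at t)"
    and "f 0 = 1" and "p \<ge> 1"
    and ode: "\<And>t. t \<in> ball 0 1 \<Longrightarrow> (1 - of_nat p / 2 * t) * f' t = f t"
    and t: "t \<in> ball 0 1"
  shows "f t \<noteq> 0"
    and "f t * (f' t + t * f'' t) - t * (f' t)\<^sup>2 = f t ^ p * (f t)\<^sup>2"
proof -
  define k where "k = (of_nat p / 2 :: complex)"
  have ode': "(1 - k * t) * f' t = f t" if "t \<in> ball 0 1" for t
    using ode[OF that] by (simp add: k_def)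
  obtain m where m: "p = Suc m"
    using \<open>p \<ge> 1\<close> by (cases p) auto
  have "((\<lambda>t. f t ^ p * (1 - k * t)\<^sup>2) has_field_derivative 0) (at t within ball 0 1)"
    if "t \<in> ball 0 1" for t
  proof -
    \<comment> \<open>The common factor \<open>of_nat p\<close> appears because
      \<open>2 * k = of_nat p\<close>; the last factor is the defect of the first order
      equation.\<close>
    have "((\<lambda>t. f t ^ p * (1 - k * t)\<^sup>2) has_field_derivative
        of_nat p * f t ^ m * (1 - k * t) * ((1 - k * t) * f' t - f t)) (at t)"
      unfolding m
      apply (rule derivative_eq_intros refl f'[OF that])+
      by (simp add: k_def m power2_eq_square field_simps)
    then show ?thesis
      using ode'[OF that] by (simp add: has_field_derivative_at_within)
  qed
  then obtain c where c: "\<And>t. t \<in> ball 0 1 \<Longrightarrow> f t ^ p * (1 - k * t)\<^sup>2 = c"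
    using has_field_derivative_zero_constant[of "ball 0 1" "\<lambda>t. f t ^ p * (1 - k * t)\<^sup>2"]
    by auto
  have "c = 1"
    using c[of 0] \<open>f 0 = 1\<close> by simp
  have inv: "f t ^ p * (1 - k * t)\<^sup>2 = 1"
    using c[OF t] \<open>c = 1\<close> by simp
  then show "f t \<noteq> 0"
    using \<open>p \<ge> 1\<close> by (auto simp: power_0_left)
  have "((\<lambda>t. (1 - k * t) * f' t) has_field_derivative (1 - k * t) * f'' t - k * f' t) (at t)"
    by (auto intro!: derivative_eq_intros f''[OF t])
  \<comment> \<open>The first order equation holds on an open disk, so both of its sides have the
    same derivative.\<close>
  then have "(f has_field_derivative (1 - k * t) * f'' t - k * f' t) (at t)"
    by (rule has_field_derivative_transform_within_open[OF _ open_ball t]) (simp add: ode')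
  from DERIV_unique[OF this f'[OF t]]
  have f''_eq: "(1 - k * t) * f'' t = (1 + k) * f' t"
    by (simp add: algebra_simps)
  define u where "u = 1 - k * t"
  have 1: "f t = u * f' t" and 2: "u * f'' t = (1 + k) * f' t" and kt: "u + k * t = 1"
    using ode'[OF t] f''_eq by (auto simp: u_def)
  have "f t * (f' t + t * f'' t) - t * (f' t)\<^sup>2
      = u * f' t * f' t + t * f' t * (u * f'' t) - t * (f' t)\<^sup>2"
    unfolding 1 by (simp add: algebra_simps)
  also have "\<dots> = (u + k * t) * (f' t)\<^sup>2"
    unfolding 2 by (simp add: algebra_simps power2_eq_square)
  also have "\<dots> = (f t ^ p * u\<^sup>2) * (f' t)\<^sup>2"
    using inv by (simp add: kt flip: u_def)
  also have "\<dots> = f t ^ p * (f t)\<^sup>2"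
    using 1 by (simp add: power_mult_distrib)
  finally show "f t * (f' t + t * f'' t) - t * (f' t)\<^sup>2 = f t ^ p * (f t)\<^sup>2" .
qed

section \<open>The recursion of the binomial coefficients\<close>

lemma gbinomial_coeff_rec:
  fixes p :: nat
  assumes "p \<ge> 1"
  defines "c \<equiv> \<lambda>n. (complex_of_real (- 2 / real p) gchoose n) * (- (of_nat p / 2)) ^ n"
  shows "of_nat (Suc n) * c (Suc n) = (1 + of_nat p / 2 * of_nat n) * c n"
proof -
  define b where "b = complex_of_real (- 2 / real p)"
  have b: "b * of_nat p = - 2"
    using assms(1) by (simp add: b_def)
  have "of_nat (Suc n) * (b gchoose Suc n) = (b - of_nat n) * (b gchoose n)"
    using gbinomial_mult_1[of b n] by (simp add: algebra_simps)
  then have "of_nat (Suc n) * c (Suc n) = (b - of_nat n) * (- (of_nat p / 2)) * c n"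
    by (simp add: c_def b_def)
  \<comment> \<open>The exponent \<open>b = - 2 / p\<close> is exactly the one for which the
    constant term \<open>- b * p / 2\<close> equals 1.\<close>
  also have "(b - of_nat n) * (- (of_nat p / 2)) = 1 + of_nat p / 2 * of_nat n"
  proof -
    have "(b - of_nat n) * (- (of_nat p / 2)) = - (b * of_nat p) / 2 + of_nat p / 2 * of_nat n"
      by (simp add: field_simps)
    then show ?thesis
      by (simp add: b)
  qed
  finally show ?thesis .
qed

lemma first_order_rec_unique:
  fixes b c :: "nat \<Rightarrow> complex"
  assumes "b 0 = c 0"
    and b: "\<And>n. of_nat (Suc n) * b (Suc n) = (1 + k * of_nat n) * b n"
    and c: "\<And>n. of_nat (Suc n) * c (Suc n) = (1 + k * of_nat n) * c n"
  shows "b n = c n"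
proof (induction n)
  case (Suc n)
  then have "of_nat (Suc n) * b (Suc n) = of_nat (Suc n) * c (Suc n)"
    by (simp only: b c)
  then show ?case
    by (simp del: of_nat_Suc)
qed (fact assms(1))

section \<open>From the kernel to one variable and back\<close>

theorem theorem2p3:
  fixes K :: "complex \<Rightarrow> complex \<Rightarrow> complex"
    and a :: "nat \<Rightarrow> complex"
    and p :: nat
  assumes summable: "\<And>z w. z \<in> ball 0 1 \<Longrightarrow> w \<in> ball 0 1 \<Longrightarrow>
            summable (\<lambda>i. a (Suc i) * z ^ Suc i * cnj w ^ Suc i)"
    and K_eq: "\<And>z w. z \<in> ball 0 1 \<Longrightarrow> w \<in> ball 0 1 \<Longrightarrow>
            K z w = 1 + (\<Sum>i. a (Suc i) * z ^ Suc i * cnj w ^ Suc i)"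
    and pos_def: "positive_definite_kernel_on (ball 0 1) K"
    and p: "p \<ge> 1"
  shows "(\<forall>z\<in>ball 0 1. \<forall>w\<in>ball 0 1.
            K z w \<noteq> 0 \<and> mixed_deriv_log K z w = K z w ^ p)
         \<longleftrightarrow>
         (\<forall>z\<in>ball 0 1. \<forall>w\<in>ball 0 1.
            (\<lambda>n. (complex_of_real (- 2 / real p) gchoose n) * (- (of_nat p * z * cnj w / 2)) ^ n)
              sums K z w)"
proof -
  \<comment> \<open>The constant term 1 of the kernel replaces \<open>a 0\<close>, whose value is
    arbitrary.\<close>
  define b where "b n = (if n = 0 then 1 else a n)" for n
  define f where "f t = (\<Sum>n. b n * t ^ n)" for t
  define c where "c n = (complex_of_real (- 2 / real p) gchoose n) * (- (of_nat p / 2)) ^ n" for n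
  \<comment> \<open>The witnesses are a square root of \<open>t\<close> and its conjugate, both of
    modulus below 1. Thus \<open>z * cnj w\<close> covers the whole disk, and statements about pairs
    become statements about \<open>t\<close>.\<close>
  have ex: "\<exists>z\<in>ball 0 1. \<exists>w\<in>ball 0 1. t = z * cnj w" if "t \<in> ball 0 1" for t
  proof (intro bexI)
    show "t = csqrt t * cnj (cnj (csqrt t))"
      by (simp flip: power2_eq_square)
    have "norm (csqrt t) < 1"
      using that by (simp add: norm_csqrt)
    then show "csqrt t \<in> ball 0 1" "cnj (csqrt t) \<in> ball 0 1"
      by simp_all
  qed
  have ball_iff: "(\<forall>t\<in>ball 0 1. P t) \<longleftrightarrow> (\<forall>z\<in>ball 0 1. \<forall>w\<in>ball 0 1. P (z * cnj w))"
    for P :: "complex \<Rightarrow> bool"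
    by (intro iffI ballI) (blast intro: mult_cnj_in_ball, use ex in fast)
  have sK: "(\<lambda>n. b n * (z * cnj w) ^ n) sums K z w" if "z \<in> ball 0 1" "w \<in> ball 0 1" for z w
  proof -
    have "(\<lambda>i. b (Suc i) * (z * cnj w) ^ Suc i) sums (K z w - 1)"
      using summable_sums[OF summable[OF that]] K_eq[OF that]
      by (simp add: b_def power_mult_distrib mult_ac)
    from sums_Suc[OF this] show ?thesis
      by (simp add: b_def)
  qed
  then have Kf: "K z w = f (z * cnj w)" if "z \<in> ball 0 1" "w \<in> ball 0 1" for z w
    using that by (simp add: f_def sums_unique)
  have sf: "(\<lambda>n. b n * t ^ n) sums f t" if "t \<in> ball 0 1" for t
    using ex[OF that] sK Kf by metis
  have "b 0 = 1" "c 0 = 1"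
    by (simp_all add: b_def c_def)
  have c_term: "c n * (z * cnj w) ^ n = (complex_of_real (- 2 / real p) gchoose n) *
      (- (of_nat p * z * cnj w / 2)) ^ n" for n z w
  proof -
    have "- (of_nat p * z * cnj w / 2) = - (of_nat p / 2) * (z * cnj w)"
      by simp
    then show ?thesis
      by (simp only: c_def power_mult_distrib mult.assoc)
  qed
  have c_rec: "of_nat (Suc n) * c (Suc n) = (1 + of_nat p / 2 * of_nat n) * c n" for n
    unfolding c_def by (rule gbinomial_coeff_rec[OF p])
  have "f 0 = 1"
    using sf[of 0] \<open>b 0 = 1\<close> by simp
  have "f holomorphic_on ball 0 1"
    by (rule power_series_holomorphic[of 0 1 b]) (use sf in simp)
  then have f': "(f has_field_derivative deriv f t) (at t)"
    and f'': "(deriv f has_field_derivative deriv (deriv f) t) (at t)" if "t \<in> ball 0 1" for t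
    using that by (auto intro!: holomorphic_derivI[OF _ open_ball] holomorphic_deriv)
  have "(\<forall>z\<in>ball 0 1. \<forall>w\<in>ball 0 1. K z w \<noteq> 0 \<and> mixed_deriv_log K z w = K z w ^ p) \<longleftrightarrow>
        (\<forall>t\<in>ball 0 1. f t \<noteq> 0 \<and>
           f t * (deriv f t + t * deriv (deriv f) t) - t * (deriv f t)\<^sup>2 = f t ^ p * (f t)\<^sup>2)"
    (is "?L \<longleftrightarrow> (\<forall>t\<in>ball 0 1. ?C t)")
  proof -
    \<comment> \<open>The nonvanishing conjunct on either side permits clearing the denominator
      \<open>(f t)\<^sup>2\<close>.\<close>
    have pt: "K z w \<noteq> 0 \<and> mixed_deriv_log K z w = K z w ^ p \<longleftrightarrow> ?C (z * cnj w)"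
      if "z \<in> ball 0 1" "w \<in> ball 0 1" for z w
      using mixed_deriv_log_mult_cnj[of f, OF f' f'' Kf that refl] Kf[OF that]
      by (auto simp: divide_eq_eq)
    show ?thesis
      by (rule trans[OF _ ball_iff[symmetric]]) (intro ball_cong refl pt)
  qed
  also have "\<dots> \<longleftrightarrow> (\<forall>t\<in>ball 0 1. (1 - of_nat p / 2 * t) * deriv f t = f t)"
  proof (intro iffI ballI conjI)
    fix t :: complex
    assume "\<forall>t\<in>ball 0 1. ?C t" "t \<in> ball 0 1"
    then show "(1 - of_nat p / 2 * t) * deriv f t = f t"
      by (intro first_order_ode_of_curvature[OF f' f'' _ \<open>f 0 = 1\<close>]) blast+
  next
    fix t :: complex
    assume ode: "\<forall>t\<in>ball 0 1. (1 - of_nat p / 2 * t) * deriv f t = f t" and t: "t \<in> ball 0 1"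
    show "f t \<noteq> 0"
      and "f t * (deriv f t + t * deriv (deriv f) t) - t * (deriv f t)\<^sup>2 = f t ^ p * (f t)\<^sup>2"
      using curvature_of_first_order_ode[OF f' f'' \<open>f 0 = 1\<close> p _ t] ode by blast+
  qed
  also have "\<dots> \<longleftrightarrow> (\<forall>n. of_nat (Suc n) * b (Suc n) = (1 + of_nat p / 2 * of_nat n) * b n)"
    by (rule powser_first_order_ode[OF sf f'])
  \<comment> \<open>Both sequences start with 1, so the recursion forces \<open>b = c\<close>;
    conversely, two expansions of \<open>f\<close> on the disk have equal coefficients.\<close>
  also have "\<dots> \<longleftrightarrow> (\<forall>t\<in>ball 0 1. (\<lambda>n. c n * t ^ n) sums f t)"
  proof
    assume rec: "\<forall>n. of_nat (Suc n) * b (Suc n) = (1 + of_nat p / 2 * of_nat n) * b n"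
    have "b n = c n" for n
      by (rule first_order_rec_unique[of b c "of_nat p / 2"])
         (use rec c_rec \<open>b 0 = 1\<close> \<open>c 0 = 1\<close> in blast | simp add: \<open>b 0 = 1\<close> \<open>c 0 = 1\<close>)+
    then have "b = c"
      by blast
    then show "\<forall>t\<in>ball 0 1. (\<lambda>n. c n * t ^ n) sums f t"
      using sf by blast
  next
    assume sc: "\<forall>t\<in>ball 0 1. (\<lambda>n. c n * t ^ n) sums f t"
    have "(\<lambda>n. (b n - c n) * t ^ n) sums 0" if "t \<in> ball 0 1" for t
      using sums_diff[OF sf[OF that] bspec[OF sc that]] by (simp add: left_diff_distrib)
    then have "b n - c n = 0" for n
      by (rule powser_coeffs_eq_0)
    then have "b = c"
      by (simp add: fun_eq_iff)
    then show "\<forall>n. of_nat (Suc n) * b (Suc n) = (1 + of_nat p / 2 * of_nat n) * b n"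
      using c_rec by blast
  qed
  also have "\<dots> \<longleftrightarrow> (\<forall>z\<in>ball 0 1. \<forall>w\<in>ball 0 1. (\<lambda>n. c n * (z * cnj w) ^ n) sums K z w)"
    by (rule trans[OF ball_iff]) (intro ball_cong refl, simp only: Kf)
  finally show ?thesis
    by (simp only: c_term)
qed

end
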